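(* Let $G=(V,E)$ be a finite undirected graph with edge weights $w_e\ge 0$, $e\in E$. Assume that $G$ has a unique maximum-weight matching $M^*$ and that the LP relaxation of the maximum-weight matching problem has a unique optimal solution. Assume that the LP relaxation is loose (i.e. not tight). Then the max-product beliefs do not converge to the correct $M^*$: for any given $k$ there exist $k_1\ge k$ and computation trees $T_e$, $e\in E$, such that each $T_e$ is full up to depth $k_1$, but the beliefs on some of the edges are incorrect. Moreover, in this case max-product does not converge at all.
   Context: **Matching and LP.** A matching is a set of edges no two of which share a node; its weight is the sum of the weights of its edges. $\mathcal{N}(i)$ is the set of neighbors of $i$ in $G$. The maximum-weight matching integer program is: maximize $\sum_{e\in E} w_ex_e$ subject to $\sum_{j\in\mathcal{N}(i)}x_{ij}\le 1$ for all $i\in V$ and $x_e\in\{0,1\}$ for all $e\in E$. The LP relaxation replaces $x_e\in\{0,1\}$ by $x_e\ge 0$. The LP relaxation is *tight* if it has a unique optimal solution and at this solution all values $x_e$ are $0$ or $1$; otherwise it is *loose*. **Max-product.** Max-product is run on the distribution $$p(x)=\frac1Z\prod_{i\in V}\mathbf 1_{\{\sum_{j\in\mathcal{N}(i)}x_{ij}\le 1\}}\prod_{e\in E}e^{w_ex_e},\qquad x\in\{0,1\}^E,$$ with edges as variables and nodes as factors. Messages are vectors indexed by $\{0,1\}$, all initialized to $1$, with updates $$m_{(i,j)\to i}^{t+1}[1]=e^{w_{ij}}m^t_{j\to(i,j)}[1],\qquad m_{(i,j)\to i}^{t+1}[0]=m^t_{j\to(i,j)}[0],$$ $$m_{i\to(i,j)}^{t+1}[1]=\prod_{k\in\mathcal{N}(i)-j}m^t_{(k,i)\to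 i}[0],$$ $$m_{i\to(i,j)}^{t+1}[0]=\max\Big\{\prod_{k\in\mathcal{N}(i)-j}m^t_{(k,i)\to i}[0],\ \max_{k\in\mathcal{N}(i)-j}m^t_{(k,i)\to i}[1]\Big\}$$ (messages considered up to the usual normalization; the second entry of the last maximum is understood as the best weight obtained by selecting exactly one of the edges $(k,i)$, $k\in\mathcal N(i)-j$). Beliefs are $$b_{(i,j)}^t[0]=m^t_{i\to(i,j)}[0]\,m^t_{j\to(i,j)}[0],\qquad b_{(i,j)}^t[1]=e^{w_{ij}}m^t_{i\to(i,j)}[1]\,m^t_{j\to(i,j)}[1].$$ Updates may be synchronous (all messages updated at every step) or asynchronous (only a subset updated at each step). **Computation tree.** The full depth-$k$ computation tree $\overline{T}_e(k)$ rooted at edge $e$ is defined recursively: $\overline{T}_e(1)$ is the single edge $e$ (the root), both of whose endpoints are leaves; $\overline{T}_e(k)$ is obtained from $\overline{T}_e(k-1)$ by adding to each leaf $v$, as children, a copy of each neighbor in $G$ of (the node copied by) $v$, except for the unique neighbor of $v$ already present in $\overline{T}_e(k-1)$. Each new edge has the weight of the edge of $G$ it copies. For synchronous updates the computation tree at time $k$ is $T_e(k)=\overline{T}_e(k)$; for asynchronous updates $T_e(k)$ is a subtree of $\overline{T}_e(k)$ containing the root. A computation tree $T_e$ is *full up to depth $k_1$* if it contains $\overline{T}_e(k_1)$. **Beliefs via the computation tree.** The max-product belief $b_e$ associated with a computation tree $T_e$ is the root belief on $T_e$: $b_e[1]>b_e[0]$ (respectively $<$) holds if and only if the maximum weight of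 a matching on $T_e$ containing the root edge is strictly larger (respectively smaller) than the maximum weight of a matching on $T_e$ not containing the root edge. This characterization may be taken as the definition of the beliefs. **Convergence.** Max-product *converges by step $k$* if the variable assignments ($0$ or $1$) that maximize the beliefs at each edge remain constant once the associated computation tree is full up to depth at least $k$ (this includes both synchronous and asynchronous updates). Max-product *converges* if it converges by step $k$ for some $k<\infty$. It *converges to the correct answer* $M^*$ if the beliefs at convergence satisfy $b_e[1]>b_e[0]$ if and only if $e\in M^*$, and $b_e[1]<b_e[0]$ if and only if $e\notin M^*$. The belief on an edge $e$ is *incorrect* if either $e\in M^*$ but $b_e[0]>b_e[1]$, or $e\notin M^*$ but $b_e[1]>b_e[0]$. *)

theory Defs
  imports Complex_Main "HOL-Library.FuncSet"
begin

text \<open>Edges are two-element sets of vertices.\<close>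

definition finite_simple_graph :: "'a set \<Rightarrow> 'a set set \<Rightarrow> bool" where
  "finite_simple_graph V E \<longleftrightarrow> finite V \<and> (\<forall>e\<in>E. e \<subseteq> V \<and> card e = 2)"

definition neighbors :: "'a set set \<Rightarrow> 'a \<Rightarrow> 'a set" where
  "neighbors E i = {j. {i, j} \<in> E}"

definition matching :: "'a set set \<Rightarrow> 'a set set \<Rightarrow> bool" where
  "matching E M \<longleftrightarrow> M \<subseteq> E \<and> (\<forall>e\<in>M. \<forall>f\<in>M. e \<noteq> f \<longrightarrow> e \<inter> f = {})"

definition max_weight_matching :: "'a set set \<Rightarrow> ('a set \<Rightarrow> real) \<Rightarrow> 'a set set \<Rightarrow> bool" where
  "max_weight_matching E w M \<longleftrightarrow>
     matching E M \<and> (\<forall>N. matching E N \<longrightarrow> sum w N \<le> sum w M)"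

text \<open>LP points are vectors indexed by \<open>E\<close>; membership in \<open>extensional E\<close> fixes the irrelevant
  values outside \<open>E\<close>, so that equality of functions is equality of vectors.\<close>

definition lp_feasible :: "'a set \<Rightarrow> 'a set set \<Rightarrow> ('a set \<Rightarrow> real) \<Rightarrow> bool" where
  "lp_feasible V E x \<longleftrightarrow> x \<in> extensional E \<and> (\<forall>e\<in>E. 0 \<le> x e) \<and>
     (\<forall>i\<in>V. (\<Sum>j\<in>neighbors E i. x {i, j}) \<le> 1)"

definition lp_optimal ::
  "'a set \<Rightarrow> 'a set set \<Rightarrow> ('a set \<Rightarrow> real) \<Rightarrow> ('a set \<Rightarrow> real) \<Rightarrow> bool" where
  "lp_optimal V E w x \<longleftrightarrow> lp_feasible V E x \<and>
     (\<forall>y. lp_feasible V E y \<longrightarrow> (\<Sum>e\<in>E. w e * y e) \<le> (\<Sum>e\<in>E. w e * x e))"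

definition lp_tight :: "'a set \<Rightarrow> 'a set set \<Rightarrow> ('a set \<Rightarrow> real) \<Rightarrow> bool" where
  "lp_tight V E w \<longleftrightarrow>
     (\<exists>x. lp_optimal V E w x \<and> (\<forall>y. lp_optimal V E w y \<longrightarrow> y = x) \<and> (\<forall>e\<in>E. x e \<in> {0, 1}))"

definition lp_loose :: "'a set \<Rightarrow> 'a set set \<Rightarrow> ('a set \<Rightarrow> real) \<Rightarrow> bool" where
  "lp_loose V E w \<longleftrightarrow> \<not> lp_tight V E w"

text \<open>A node of a computation tree is a list: its head is the copied vertex of the graph, and its
  tail records the way back to the root. The two endpoints of the root edge of the tree for
  \<open>e = {u, v}\<close> are \<open>[u, v]\<close> (a copy of \<open>u\<close>) and \<open>[v, u]\<close> (a copy of \<open>v\<close>); a child of \<open>p\<close> copying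
  \<open>x\<close> is \<open>x # p\<close>. A tree is represented by its set of edges, since it has no isolated nodes.\<close>

definition root_edge :: "'a set \<Rightarrow> 'a list set" where
  "root_edge e = {[u, v] | u v. e = {u, v}}"

definition leaf :: "'b set set \<Rightarrow> 'b \<Rightarrow> bool" where
  "leaf T p \<longleftrightarrow> card {t \<in> T. p \<in> t} = 1"

text \<open>Depths start at 1; at depth 0 the tree is empty, so fullness up to depth 0 is no condition.\<close>

fun full_tree :: "'a set set \<Rightarrow> 'a set \<Rightarrow> nat \<Rightarrow> 'a list set set" where
  "full_tree E e 0 = {}"
| "full_tree E e (Suc 0) = {root_edge e}"
| "full_tree E e (Suc (Suc k)) = full_tree E e (Suc k) \<union>
     {{p, x # p} | p x. leaf (full_tree E e (Suc k)) p \<and>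
        x \<in> neighbors E (hd p) - hd ` neighbors (full_tree E e (Suc k)) p}"

definition connected_edges :: "'b set set \<Rightarrow> bool" where
  "connected_edges T \<longleftrightarrow> (\<forall>p\<in>\<Union>T. \<forall>q\<in>\<Union>T. (p, q) \<in> {(a, b). {a, b} \<in> T}\<^sup>*)"

definition computation_tree :: "'a set set \<Rightarrow> 'a set \<Rightarrow> 'a list set set \<Rightarrow> bool" where
  "computation_tree E e T \<longleftrightarrow>
     (\<exists>k. T \<subseteq> full_tree E e k) \<and> root_edge e \<in> T \<and> connected_edges T"

definition full_up_to :: "'a set set \<Rightarrow> 'a set \<Rightarrow> nat \<Rightarrow> 'a list set set \<Rightarrow> bool" where
  "full_up_to E e k T \<longleftrightarrow> full_tree E e k \<subseteq> T"

text \<open>The edge of the graph copied by a tree edge \<open>t\<close> is \<open>hd ` t\<close>.\<close>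

definition tree_weight :: "('a set \<Rightarrow> real) \<Rightarrow> 'a list set set \<Rightarrow> real" where
  "tree_weight w N = (\<Sum>t\<in>N. w (hd ` t))"

text \<open>Logarithm of the root belief, i.e. of the max-marginal of the root edge on the tree \<open>T\<close>;
  \<open>True\<close> and \<open>False\<close> stand for the values 1 and 0 of the edge variable.\<close>

definition belief :: "('a set \<Rightarrow> real) \<Rightarrow> 'a set \<Rightarrow> 'a list set set \<Rightarrow> bool \<Rightarrow> real" where
  "belief w e T b = Max {tree_weight w N | N. matching T N \<and> (root_edge e \<in> N \<longleftrightarrow> b)}"

definition best_assignments :: "('a set \<Rightarrow> real) \<Rightarrow> 'a set \<Rightarrow> 'a list set set \<Rightarrow> bool set" where
  "best_assignments w e T = {b. \<forall>c. belief w e T c \<le> belief w e T b}"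

definition incorrect_belief ::
  "('a set \<Rightarrow> real) \<Rightarrow> 'a set set \<Rightarrow> 'a set \<Rightarrow> 'a list set set \<Rightarrow> bool" where
  "incorrect_belief w M e T \<longleftrightarrow>
     (e \<in> M \<and> belief w e T False > belief w e T True) \<or>
     (e \<notin> M \<and> belief w e T True > belief w e T False)"

definition converges_by :: "'a set set \<Rightarrow> ('a set \<Rightarrow> real) \<Rightarrow> nat \<Rightarrow> bool" where
  "converges_by E w k \<longleftrightarrow> (\<forall>e\<in>E. \<exists>A. \<forall>T.
     computation_tree E e T \<and> full_up_to E e k T \<longrightarrow> best_assignments w e T = A)"

definition max_product_converges :: "'a set set \<Rightarrow> ('a set \<Rightarrow> real) \<Rightarrow> bool" where
  "max_product_converges E w \<longleftrightarrow> (\<exists>k. converges_by E w k)"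

definition max_product_converges_to ::
  "'a set set \<Rightarrow> ('a set \<Rightarrow> real) \<Rightarrow> 'a set set \<Rightarrow> bool" where
  "max_product_converges_to E w M \<longleftrightarrow> (\<exists>k. converges_by E w k \<and>
     (\<forall>e\<in>E. \<forall>T. computation_tree E e T \<and> full_up_to E e k T \<longrightarrow>
        (belief w e T True > belief w e T False \<longleftrightarrow> e \<in> M) \<and>
        (belief w e T True < belief w e T False \<longleftrightarrow> e \<notin> M)))"

end

theory Submission imports Defs begin

text \<open>Let \<open>X\<close> be the unique LP optimum. Lift its support to a computation tree and select there,
  greedily from the root, a matching \<open>M\<close> of positive edges that covers every copy of a saturated
  node; if the root edge \<open>e\<close> is fractional, it can be put into \<open>M\<close> or left out at will. A tree of
  finite depth is enlarged by the edges of \<open>M\<close> that leave it, so that \<open>M\<close> also covers the copies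
  at its boundary. For any other matching \<open>N\<close> of this tree, the projection of \<open>N - M\<close> to the graph
  is a feasible direction at \<open>X\<close>, hence \<open>N\<close> is not heavier than \<open>M\<close>. If the weights agree, the
  projection vanishes, \<open>N\<close> and \<open>M\<close> cover the same nodes, and two such matchings of a forest are
  equal. So for a fractional edge both root values occur as strict maximizers at every depth.\<close>

section \<open>Linear algebra and finite families of inequalities\<close>

text \<open>Gaussian elimination, one row at a time: a zero row is dropped; otherwise a pivot
  \<open>z\<close> is eliminated from the other rows, giving the coefficients \<open>a'\<close>, and
  back-substitution then determines the value at \<open>z\<close>.\<close>

lemma underdetermined_system:
  fixes a :: "'r \<Rightarrow> 'x \<Rightarrow> real"
  assumes "finite R" "finite X" "card R < card X"
  shows "\<exists>d. (\<exists>x\<in>X. d x \<noteq> 0) \<and> (\<forall>r\<in>R. (\<Sum>x\<in>X. a r x * d x) = 0)"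
  using assms
proof (induction R arbitrary: X a rule: finite_induct)
  case empty
  then have "X \<noteq> {}" by auto
  then show ?case by (intro exI[of _ "\<lambda>_. 1"]) auto
next
  case (insert r R)
  show ?case
  proof (cases "\<forall>x\<in>X. a r x = 0")
    case True
    have "card R < card X" using insert by simp
    from insert.IH[OF insert.prems(1) this, of a] obtain d
      where "\<exists>x\<in>X. d x \<noteq> 0" "\<forall>r\<in>R. (\<Sum>x\<in>X. a r x * d x) = 0" by blast
    then show ?thesis using True by (intro exI[of _ d]) auto
  next
    case False
    then obtain z where z: "z \<in> X" "a r z \<noteq> 0" by blast
    let ?Y = "X - {z}"
    define a' where "a' = (\<lambda>s x. a s x - a s z * a r x / a r z)"
    have "card R < card ?Y" using insert z by simp
    from insert.IH[OF _ this, of a'] insert.prems obtain d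
      where d: "\<exists>x\<in>?Y. d x \<noteq> 0" "\<And>s. s \<in> R \<Longrightarrow> (\<Sum>x\<in>?Y. a' s x * d x) = 0" by blast
    define S where "S = (\<Sum>x\<in>?Y. a r x * d x)"
    define d' where "d' = d(z := - S / a r z)"
    have split: "(\<Sum>x\<in>X. a s x * d' x) = - a s z * S / a r z + (\<Sum>x\<in>?Y. a s x * d x)" for s
    proof -
      have "(\<Sum>x\<in>?Y. a s x * d' x) = (\<Sum>x\<in>?Y. a s x * d x)"
        by (intro sum.cong) (auto simp: d'_def)
      then show ?thesis
        using sum.remove[OF insert.prems(1) z(1), of "\<lambda>x. a s x * d' x"] by (simp add: d'_def)
    qed
    have "(\<Sum>x\<in>X. a s x * d' x) = 0" if "s \<in> R" for s
    proof -
      have "0 = (\<Sum>x\<in>?Y. a' s x * d x)" using d(2)[OF that] by simp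
      also have "\<dots> = (\<Sum>x\<in>?Y. a s x * d x - (a s z / a r z) * (a r x * d x))"
        by (intro sum.cong) (auto simp: a'_def field_simps z)
      also have "\<dots> = (\<Sum>x\<in>?Y. a s x * d x) - (a s z / a r z) * S"
        by (simp add: sum_subtractf S_def sum_distrib_left)
      finally show ?thesis using split[of s] by simp
    qed
    moreover have "(\<Sum>x\<in>X. a r x * d' x) = 0"
      using split[of r] z by (simp add: S_def)
    moreover have "\<exists>x\<in>X. d' x \<noteq> 0" using d(1) by (auto simp: d'_def)
    ultimately show ?thesis by (intro exI[of _ d']) auto
  qed
qed

text \<open>Where \<open>f a\<close> is positive and \<open>g a\<close> negative, steps up to
  \<open>f a / - g a\<close> are harmless; finitely many such bounds have a positive minimum. With
  \<open>f\<close> the slacks of the LP constraints, this keeps small steps feasible.\<close>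

lemma small_step_nonneg:
  fixes f g :: "'b \<Rightarrow> real"
  assumes "finite A" "\<And>a. a \<in> A \<Longrightarrow> 0 \<le> f a" "\<And>a. a \<in> A \<Longrightarrow> f a = 0 \<Longrightarrow> 0 \<le> g a"
  shows "\<exists>\<epsilon>>0. \<forall>\<delta>. 0 < \<delta> \<and> \<delta> \<le> \<epsilon> \<longrightarrow> (\<forall>a\<in>A. 0 \<le> f a + \<delta> * g a)"
  using assms
proof (induction A rule: finite_induct)
  case empty
  then show ?case by (auto intro: exI[of _ 1])
next
  case (insert a A)
  then obtain \<epsilon> where \<epsilon>: "\<epsilon> > 0" "\<And>\<delta> b. 0 < \<delta> \<Longrightarrow> \<delta> \<le> \<epsilon> \<Longrightarrow> b \<in> A \<Longrightarrow> 0 \<le> f b + \<delta> * g b"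
    by (metis insertCI)
  have "\<exists>\<eta>>0. \<forall>\<delta>. 0 < \<delta> \<and> \<delta> \<le> \<eta> \<longrightarrow> 0 \<le> f a + \<delta> * g a"
  proof (cases "g a \<ge> 0")
    case True
    then show ?thesis using insert.prems(1)[of a] by (intro exI[of _ 1]) auto
  next
    case False
    then have pos: "f a > 0" using insert.prems[of a] by force
    have "0 \<le> f a + \<delta> * g a" if "\<delta> \<le> f a / - g a" for \<delta>
      using that False by (simp add: field_simps)
    then show ?thesis using pos False
      by (intro exI[of _ "f a / - g a"]) (auto simp: divide_pos_neg)
  qed
  then obtain \<eta> where "\<eta> > 0" "\<And>\<delta>. 0 < \<delta> \<Longrightarrow> \<delta> \<le> \<eta> \<Longrightarrow> 0 \<le> f a + \<delta> * g a" by blast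
  then show ?case using \<epsilon> by (intro exI[of _ "min \<epsilon> \<eta>"]) auto
qed

section \<open>The LP optimum: feasible directions and saturated nodes\<close>

text \<open>The left-hand side of the LP constraint at \<open>i\<close>, for arbitrary edge vectors,
  so that it also applies to directions and to projections of tree matchings.\<close>

definition load :: "'a set set \<Rightarrow> ('a set \<Rightarrow> real) \<Rightarrow> 'a \<Rightarrow> real" where
  "load E x i = (\<Sum>j\<in>neighbors E i. x {i, j})"

locale fin_graph =
  fixes V :: "'a set" and E :: "'a set set"
  assumes graph: "finite_simple_graph V E"
begin

lemma finite_V: "finite V" and edge_subset: "f \<in> E \<Longrightarrow> f \<subseteq> V" and edge_card: "f \<in> E \<Longrightarrow> card f = 2"
  using graph by (auto simp: finite_simple_graph_def)

lemma finite_E: "finite E"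
  using finite_V edge_subset by (meson finite_Pow_iff PowI finite_subset subsetI)

lemma edge_neq: "{i, j} \<in> E \<Longrightarrow> i \<noteq> j"
  using edge_card[of "{i, j}"] by auto

lemma edge_in_V: "{i, j} \<in> E \<Longrightarrow> i \<in> V" "{i, j} \<in> E \<Longrightarrow> j \<in> V"
  using edge_subset by auto

lemma edge_other_end:
  assumes "f \<in> E" "i \<in> f"
  obtains j where "j \<in> neighbors E i" "f = {i, j}"
proof -
  obtain u v where "f = {u, v}" using edge_card[OF assms(1)] by (auto simp: card_2_iff)
  then have "f = {i, u} \<or> f = {i, v}" using assms(2) by auto
  then show thesis using assms(1) that by (auto simp: neighbors_def)
qed

lemma load_eq_sum_incident: "load E x i = (\<Sum>f\<in>{f \<in> E. i \<in> f}. x f)"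
proof -
  have "bij_betw (\<lambda>j. {i, j}) (neighbors E i) {f \<in> E. i \<in> f}"
  proof (rule bij_betw_imageI)
    show "(\<lambda>j. {i, j}) ` neighbors E i = {f \<in> E. i \<in> f}"
      by (auto simp: neighbors_def) (metis edge_other_end imageI mem_Collect_eq neighbors_def)
  qed (auto simp: inj_on_def doubleton_eq_iff)
  then show ?thesis
    unfolding load_def by (rule sum.reindex_bij_betw)
qed

end

locale unique_lp = fin_graph V E for V :: "'a set" and E :: "'a set set" +
  fixes w X :: "'a set \<Rightarrow> real"
  assumes optimal: "lp_optimal V E w X"
    and unique: "lp_optimal V E w y \<Longrightarrow> y = X"
begin

lemma X_nonneg: "f \<in> E \<Longrightarrow> 0 \<le> X f" and load_le: "i \<in> V \<Longrightarrow> load E X i \<le> 1"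
  using optimal by (auto simp: lp_optimal_def lp_feasible_def load_def)

lemma edges_le_load:
  assumes "i \<in> V" "A \<subseteq> {f \<in> E. i \<in> f}"
  shows "sum X A \<le> load E X i"
  unfolding load_eq_sum_incident
  using assms X_nonneg finite_E by (intro sum_mono2) auto

lemma X_le_load: "f \<in> E \<Longrightarrow> i \<in> f \<Longrightarrow> X f \<le> load E X i"
  using edges_le_load[of i "{f}"] edge_subset by auto

lemma X_le_1: "f \<in> E \<Longrightarrow> X f \<le> 1"
  using X_le_load load_le edge_subset edge_card
  by (metis card.empty ex_in_conv order_trans subsetD zero_neq_numeral)

lemma two_edges_le_1:
  assumes "f \<in> E" "g \<in> E" "f \<noteq> g" "i \<in> f" "i \<in> g"
  shows "X f + X g \<le> 1"
proof -
  have "i \<in> V" using assms edge_subset by blast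
  then have "sum X {f, g} \<le> 1"
    using edges_le_load[of i "{f, g}"] load_le[of i] assms by auto
  then show ?thesis using assms(3) by simp
qed

text \<open>The two hypotheses make \<open>d\<close> a feasible direction at \<open>X\<close>. A
  small step along it cannot improve the optimum, and if it preserves the value, it ends at another
  optimum, which uniqueness identifies with \<open>X\<close>.\<close>

lemma perturbation:
  assumes neg: "\<And>f. f \<in> E \<Longrightarrow> d f < 0 \<Longrightarrow> X f > 0"
    and sat: "\<And>i. i \<in> V \<Longrightarrow> load E X i = 1 \<Longrightarrow> load E d i \<le> 0"
  shows "(\<Sum>f\<in>E. w f * d f) \<le> 0"
    and "(\<Sum>f\<in>E. w f * d f) = 0 \<Longrightarrow> f \<in> E \<Longrightarrow> d f = 0"
proof -
  have "\<exists>\<epsilon>>0. \<forall>\<delta>. 0 < \<delta> \<and> \<delta> \<le> \<epsilon> \<longrightarrow> (\<forall>f\<in>E. 0 \<le> X f + \<delta> * d f)"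
    using finite_E X_nonneg neg by (intro small_step_nonneg) force+
  then obtain \<epsilon>1 where 1: "\<epsilon>1 > 0" "\<And>\<delta> f. 0 < \<delta> \<Longrightarrow> \<delta> \<le> \<epsilon>1 \<Longrightarrow> f \<in> E \<Longrightarrow> 0 \<le> X f + \<delta> * d f"
    by blast
  have "\<exists>\<epsilon>>0. \<forall>\<delta>. 0 < \<delta> \<and> \<delta> \<le> \<epsilon> \<longrightarrow>
      (\<forall>i\<in>V. 0 \<le> (1 - load E X i) + \<delta> * (- load E d i))"
    using finite_V load_le sat by (intro small_step_nonneg) force+
  then obtain \<epsilon>2 where 2: "\<epsilon>2 > 0"
      "\<And>\<delta> i. 0 < \<delta> \<Longrightarrow> \<delta> \<le> \<epsilon>2 \<Longrightarrow> i \<in> V \<Longrightarrow> 0 \<le> (1 - load E X i) + \<delta> * (- load E d i)"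
    by blast
  define \<epsilon> where "\<epsilon> = min \<epsilon>1 \<epsilon>2"
  have \<epsilon>: "\<epsilon> > 0" "\<epsilon> \<le> \<epsilon>1" "\<epsilon> \<le> \<epsilon>2" using 1 2 by (auto simp: \<epsilon>_def)
  define y where "y = restrict (\<lambda>f. X f + \<epsilon> * d f) E"
  have "load E y i = load E X i + \<epsilon> * load E d i" for i
    by (auto simp: load_eq_sum_incident y_def sum.distrib sum_distrib_left)
  then have "load E y i \<le> 1" if "i \<in> V" for i
    using 2(2)[OF \<epsilon>(1,3) that] by simp
  then have feasible: "lp_feasible V E y"
    using 1(2)[OF \<epsilon>(1,2)]
    unfolding lp_feasible_def load_def[symmetric] by (auto simp: y_def)
  have val: "(\<Sum>f\<in>E. w f * y f) = (\<Sum>f\<in>E. w f * X f) + \<epsilon> * (\<Sum>f\<in>E. w f * d f)"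
    by (auto simp: y_def sum_distrib_left sum.distrib[symmetric] algebra_simps intro!: sum.cong)
  moreover have "(\<Sum>f\<in>E. w f * y f) \<le> (\<Sum>f\<in>E. w f * X f)"
    using optimal feasible by (auto simp: lp_optimal_def)
  ultimately show "(\<Sum>f\<in>E. w f * d f) \<le> 0"
    using \<epsilon> by (simp add: mult_le_0_iff)
  show "d f = 0" if "(\<Sum>f\<in>E. w f * d f) = 0" "f \<in> E"
  proof -
    have "lp_optimal V E w y"
      using optimal feasible val that(1) by (auto simp: lp_optimal_def)
    then have "y f = X f" using unique by simp
    then show ?thesis using that(2) \<epsilon> by (simp add: y_def)
  qed
qed

text \<open>The fractional edges support no nonzero vector with vanishing load at every saturated node,
  so they are at most as many as the saturated nodes they meet. Each of these nodes meets at least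
  two of them; by double counting, no endpoint is left over to be unsaturated.\<close>

lemma positive_edge_saturated:
  assumes "f \<in> E" "X f > 0" "i \<in> f"
  shows "load E X i = 1"
proof (rule ccontr)
  assume unsat: "load E X i \<noteq> 1"
  define H where "H = {f \<in> E. 0 < X f \<and> X f < 1}"
  define R where "R = {i \<in> V. load E X i = 1 \<and> (\<exists>f\<in>H. i \<in> f)}"
  define deg where "deg i = card {f \<in> H. i \<in> f}" for i
  have fin: "finite H" "finite R" using finite_E finite_V by (auto simp: H_def R_def)
  have HE: "H \<subseteq> E" by (auto simp: H_def)
  have iV: "i \<in> V" using assms edge_subset by blast
  have "X f < 1"
    using X_le_load[OF assms(1,3)] load_le[OF iV] unsat by linarith
  then have fH: "f \<in> H" using assms by (auto simp: H_def)
  have "card H \<le> card R"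
  proof (rule ccontr)
    assume "\<not> card H \<le> card R"
    \<comment> \<open>The unknowns are the values on \<open>H\<close>; the equations demand zero
      load at the nodes of \<open>R\<close>.\<close>
    then obtain d where d: "\<exists>f\<in>H. d f \<noteq> 0"
        "\<And>i. i \<in> R \<Longrightarrow> (\<Sum>f\<in>H. of_bool (i \<in> f) * d f) = (0::real)"
      using underdetermined_system[OF fin(2,1), of "\<lambda>i f. of_bool (i \<in> f)"] by auto
    define d' where "d' = (\<lambda>f. if f \<in> H then d f else 0)"
    have load_d': "load E d' j = 0" if "j \<in> V" "load E X j = 1" for j
    proof -
      have "load E d' j = (\<Sum>f\<in>{f \<in> H. j \<in> f}. d f)"
        unfolding load_eq_sum_incident d'_def using finite_E HE
        by (intro sum.mono_neutral_cong_right) auto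
      also have "\<dots> = (\<Sum>f\<in>H. of_bool (j \<in> f) * d f)"
        using fin by (intro sum.mono_neutral_cong_left) auto
      also have "\<dots> = 0"
      proof (cases "j \<in> R")
        \<comment> \<open>A saturated node outside \<open>R\<close> meets no edge of
          \<open>H\<close>.\<close>
        case False
        then show ?thesis using that by (intro sum.neutral) (auto simp: R_def)
      qed (use d in auto)
      finally show ?thesis .
    qed
    have neg: "load E (\<lambda>f. - d' f) j = - load E d' j" for j
      by (simp add: load_def sum_negf)
    have supp: "d' f \<noteq> 0 \<Longrightarrow> X f > 0" for f by (auto simp: d'_def H_def split: if_splits)
    \<comment> \<open>Both \<open>d'\<close> and its negative are feasible directions, so the
      objective is constant along \<open>d'\<close>, and uniqueness forces \<open>d'\<close> to
      vanish on \<open>E\<close>.\<close>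
    have a: "(\<Sum>f\<in>E. w f * d' f) \<le> 0" using supp load_d' by (intro perturbation) auto
    have b: "(\<Sum>f\<in>E. w f * - d' f) \<le> 0"
      using supp load_d' by (intro perturbation) (auto simp: neg)
    have "(\<Sum>f\<in>E. w f * d' f) = 0" using a b by (simp add: sum_negf)
    then have "d' g = 0" if "g \<in> E" for g
      using perturbation(2)[of d' g] supp load_d' that by auto
    then have "d f = 0" if "f \<in> H" for f using that HE by (metis d'_def subsetD)
    then show False using d(1) by blast
  qed
  \<comment> \<open>If \<open>g\<close> were the only fractional edge at \<open>j\<close>, the other
    edges there would be 0, as a value 1 cannot coexist with \<open>X g > 0\<close>. The load at
    \<open>j\<close> would then be \<open>X g < 1\<close>.\<close>
  have deg2: "deg j \<ge> 2" if j: "j \<in> R" for j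
  proof (rule ccontr)
    obtain g where g: "g \<in> H" "j \<in> g" using j by (auto simp: R_def)
    assume "\<not> deg j \<ge> 2"
    moreover have "deg j > 0" using g fin unfolding deg_def by (auto simp: card_gt_0_iff)
    ultimately have "card {f \<in> H. j \<in> f} = 1" by (simp add: deg_def)
    then obtain h where h: "{f \<in> H. j \<in> f} = {h}" by (rule card_1_singletonE)
    moreover have "g \<in> {f \<in> H. j \<in> f}" using g by simp
    ultimately have only: "{f \<in> H. j \<in> f} = {g}" by simp
    have zero: "X h = 0" if "h \<in> E" "j \<in> h" "h \<noteq> g" for h
    proof (rule ccontr)
      assume "X h \<noteq> 0"
      then have "X h > 0" using X_nonneg that by force
      moreover have "h \<notin> H" using only that by blast
      ultimately have "X h = 1" using X_le_1 that by (fastforce simp: H_def)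
      then show False using two_edges_le_1[of g h j] g that by (auto simp: H_def)
    qed
    have "load E X j = (\<Sum>f\<in>{g}. X f)"
      unfolding load_eq_sum_incident using finite_E g HE zero
      by (intro sum.mono_neutral_cong_right) auto
    then show False using g j by (auto simp: H_def R_def)
  qed
  \<comment> \<open>Double counting of incidences: each edge of \<open>H\<close> has two
    ends.\<close>
  have "(\<Sum>j\<in>V. deg j) = (\<Sum>j\<in>V. \<Sum>f\<in>H. of_bool (j \<in> f))"
    using fin by (auto simp: deg_def of_bool_def sum.If_cases Int_def intro!: sum.cong)
  also have "\<dots> = (\<Sum>f\<in>H. \<Sum>j\<in>V. of_bool (j \<in> f))" by (rule sum.swap)
  also have "\<dots> = (\<Sum>f\<in>H. 2)"
  proof (rule sum.cong)
    fix f assume "f \<in> H"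
    then have "{j \<in> V. j \<in> f} = f" "card f = 2" using HE edge_subset edge_card by auto
    then show "(\<Sum>j\<in>V. of_bool (j \<in> f)) = (2::nat)"
      using finite_V by (auto simp: of_bool_def sum.If_cases Int_def)
  qed simp
  finally have total: "(\<Sum>j\<in>V. deg j) = 2 * card H" by simp
  have iR: "i \<notin> R" using unsat by (simp add: R_def)
  \<comment> \<open>The unsaturated \<open>i\<close> contributes an incidence beyond the two at each
    node of \<open>R\<close>, so \<open>H\<close> has more than \<open>card R\<close> edges.\<close>
  have "1 \<le> deg i"
    using fH assms(3) fin unfolding deg_def by (auto simp: Suc_le_eq card_gt_0_iff)
  moreover have "2 * card R \<le> (\<Sum>j\<in>R. deg j)"
    using sum_mono[of R "\<lambda>_. 2" deg] deg2 by simp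
  moreover have "(\<Sum>j\<in>insert i R. deg j) \<le> (\<Sum>j\<in>V. deg j)"
    using finite_V iV by (intro sum_mono2) (auto simp: R_def)
  ultimately have "2 * card R + 1 \<le> 2 * card H"
    using total fin iR by simp
  then show False using \<open>card H \<le> card R\<close> by simp
qed

end

subsection \<open>Computation trees as non-backtracking walks\<close>

text \<open>Walks read backwards from their last vertex, starting with either orientation of
  \<open>e\<close> and never reversing the edge just used. This description replaces growth by
  rounds of leaves with induction along one walk.\<close>

inductive_set nodes :: "'a set set \<Rightarrow> 'a set \<Rightarrow> 'a list set" for E e where
  root: "e = {u, v} \<Longrightarrow> [u, v] \<in> nodes E e"
| child: "p \<in> nodes E e \<Longrightarrow> x \<in> neighbors E (hd p) \<Longrightarrow> x \<noteq> hd (tl p) \<Longrightarrow> x # p \<in> nodes E e"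

text \<open>The two ends of the root edge count as each other's parent, so that every edge of the tree
  is the parent edge of a node.\<close>

definition parent :: "'a list \<Rightarrow> 'a list" where
  "parent p = (if length p \<le> 2 then rev p else tl p)"

definition up :: "'a list \<Rightarrow> 'a list set" where
  "up p = {p, parent p}"

locale graph_edge = fin_graph V E for V :: "'a set" and E :: "'a set set" +
  fixes e :: "'a set"
  assumes e: "e \<in> E"
begin

abbreviation "nds \<equiv> nodes E e"

lemma node_length: "p \<in> nds \<Longrightarrow> length p \<ge> 2"
  by (induction rule: nodes.induct) auto

lemma node_shape:
  assumes "p \<in> nds"
  obtains x y q where "p = x # y # q"
  using node_length[OF assms] by (metis One_nat_def Suc_1 Suc_le_length_iff)

lemma node_edge: "p \<in> nds \<Longrightarrow> {hd p, hd (tl p)} \<in> E"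
  by (induction rule: nodes.induct) (use e in \<open>auto simp: neighbors_def insert_commute\<close>)

lemma node_lists: "p \<in> nds \<Longrightarrow> set p \<subseteq> V"
  by (induction rule: nodes.induct) (use e edge_subset edge_in_V in \<open>auto simp: neighbors_def\<close>)

lemma hd_parent: "p \<in> nds \<Longrightarrow> hd (parent p) = hd (tl p)"
  by (erule node_shape) (auto simp: parent_def)

lemma parent_child: "p \<in> nds \<Longrightarrow> parent (x # p) = p"
  using node_length by (force simp: parent_def)

lemma parent_node:
  assumes "p \<in> nds"
  shows "parent p \<in> nds"
  using assms
proof (cases rule: nodes.cases)
  case (root u v)
  then show ?thesis by (auto simp: parent_def insert_commute intro: nodes.root)
qed (auto simp: parent_child)

lemma length_parent: "p \<in> nds \<Longrightarrow> length (parent p) = max 2 (length p - 1)"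
  using node_length[of p] by (auto simp: parent_def)

lemma hd_up: "p \<in> nds \<Longrightarrow> hd ` up p = {hd p, hd (tl p)}"
  by (auto simp: up_def hd_parent)

lemma hd_up_edge: "p \<in> nds \<Longrightarrow> hd ` up p \<in> E"
  by (simp add: hd_up node_edge)

lemma hd_parent_neq: "p \<in> nds \<Longrightarrow> hd (parent p) \<noteq> hd p"
  using node_edge edge_neq hd_parent by metis

lemma inj_on_hd_up: "p \<in> nds \<Longrightarrow> inj_on hd (up p)"
  using hd_parent_neq by (force simp: up_def inj_on_def)

lemma up_root:
  assumes "p \<in> nds" "length p \<le> 2"
  shows "up p = root_edge e"
  using assms
  by (cases rule: nodes.cases)
    (use node_length in \<open>force simp: up_def parent_def root_edge_def doubleton_eq_iff\<close>)+

lemma root_node: obtains p where "p \<in> nds" "length p = 2"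
proof -
  obtain u v where "e = {u, v}" using edge_card[OF e] by (auto simp: card_2_iff)
  then have "[u, v] \<in> nds" by (rule nodes.root)
  then show thesis by (rule that) simp
qed

text \<open>Below the root the two ends of \<open>up p\<close> differ in length and the longer one
  is \<open>p\<close>; only the root edge has ends of equal length and hence two names.\<close>

lemma up_eqD:
  assumes "up p = up q" "p \<in> nds" "q \<in> nds"
  shows "p = q \<or> length p = 2 \<and> length q = 2"
  using assms length_parent[of p] length_parent[of q] node_length[of p] node_length[of q]
  by (auto simp: up_def doubleton_eq_iff max_def split: if_splits)

text \<open>By the rule that produced \<open>q\<close>, an edge at \<open>p\<close> is its parent
  edge or leads to a child. The first case compares edges instead of nodes because the root edge is
  \<open>up\<close> of both its ends.\<close>

lemma incident_cases:
  assumes "p \<in> nds" "q \<in> nds" "p \<in> up q"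
  obtains "up q = up p" | x where "q = x # p" "x \<in> neighbors E (hd p)" "x \<noteq> hd (tl p)"
  using assms(2)
proof (cases rule: nodes.cases)
  case (root u v)
  then have "up q = up p" using assms(3) by (auto simp: up_def parent_def)
  then show ?thesis using that by blast
next
  case (child r x)
  then have "p = q \<or> p = r" using assms(3) by (auto simp: up_def parent_child)
  then show ?thesis using child that by blast
qed

lemma finite_nodes: "finite {p \<in> nds. length p \<le> n}"
  by (rule finite_subset[OF _ finite_lists_length_le[OF finite_V, of n]]) (auto dest: node_lists)

lemma mem_up_node: "p \<in> up q \<Longrightarrow> q \<in> nds \<Longrightarrow> p \<in> nds"
  by (auto simp: up_def parent_node)

lemma mem_up_length: "p \<in> up q \<Longrightarrow> q \<in> nds \<Longrightarrow> length p \<le> length q"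
  using length_parent[of q] node_length[of q] by (auto simp: up_def)

text \<open>The shift by one arises because the ends of the root edge, at depth 1, are lists of
  length 2.\<close>

lemma full_tree_eq: "full_tree E e (Suc k) = up ` {p \<in> nds. length p \<le> k + 2}"
proof (induction k)
  case 0
  obtain p where "p \<in> nds" "length p = 2" by (rule root_node)
  then have "up p \<in> up ` {p \<in> nds. length p \<le> 2}" "up p = root_edge e"
    using up_root by auto
  then show ?case by (auto simp: up_root)
next
  case (Suc k)
  define T where "T = up ` {p \<in> nds. length p \<le> k + 2}"
  let ?C = "{{p, x # p} | p x. leaf T p \<and> x \<in> neighbors E (hd p) - hd ` neighbors T p}"
  \<comment> \<open>The parent of a leaf is among its neighbors, so excluding the vertices copied
    there prevents backtracking.\<close>
  have C_sub: "?C \<subseteq> up ` {p \<in> nds. length p \<le> Suc k + 2}"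
  proof safe
    fix p x assume p: "leaf T p" "x \<in> neighbors E (hd p)" "x \<notin> hd ` neighbors T p"
    from p(1) obtain t where "t \<in> T" "p \<in> t"
      unfolding leaf_def by (metis (no_types, lifting) card_1_singletonE insertI1 mem_Collect_eq)
    then have pn: "p \<in> nds" "length p \<le> k + 2"
      using mem_up_node mem_up_length by (force simp: T_def)+
    then have "parent p \<in> neighbors T p" by (auto simp: T_def neighbors_def up_def)
    then have "hd (tl p) \<noteq> x" using p(3) hd_parent[OF pn(1)] by (metis imageI)
    then have "x # p \<in> nds" using pn p(2) by (auto intro: nodes.child)
    moreover have "{p, x # p} = up (x # p)" using pn by (auto simp: up_def parent_child)
    ultimately show "{p, x # p} \<in> up ` {p \<in> nds. length p \<le> Suc k + 2}" using pn by auto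
  qed
  have sup: "up q \<in> T \<union> ?C" if q: "q \<in> nds" "length q \<le> Suc k + 2" for q
  proof (cases "length q \<le> k + 2")
    case True
    then show ?thesis using q by (auto simp: T_def)
  next
    case False
    from q(1) show ?thesis
    proof (cases rule: nodes.cases)
      case (root u v)
      then show ?thesis using False by simp
    next
      case (child p x)
      then have len: "length p = k + 2" using q False by simp
      \<comment> \<open>A node of maximal length meets only its parent edge, so it is a leaf and
        only the vertex of its parent is excluded.\<close>
      have inc: "{t \<in> T. p \<in> t} = {up p}"
      proof
        show "{up p} \<subseteq> {t \<in> T. p \<in> t}" using child len by (auto simp: T_def up_def)
        show "{t \<in> T. p \<in> t} \<subseteq> {up p}"
        proof
          fix t assume "t \<in> {t \<in> T. p \<in> t}"
          then obtain r where r: "t = up r" "r \<in> nds" "length r \<le> k + 2" "p \<in> up r"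
            by (auto simp: T_def)
          have "up r = up p" by (rule incident_cases[OF child(2) r(2,4)]) (use r len in auto)
          then show "t \<in> {up p}" using r by simp
        qed
      qed
      have "neighbors T p \<subseteq> {parent p}"
      proof
        fix r assume "r \<in> neighbors T p"
        then have "{p, r} \<in> {t \<in> T. p \<in> t}" by (simp add: neighbors_def)
        then have "{p, r} = up p" unfolding inc by simp
        then show "r \<in> {parent p}" by (auto simp: up_def doubleton_eq_iff)
      qed
      then have "x \<notin> hd ` neighbors T p" using child hd_parent by auto
      moreover have "leaf T p" using inc by (simp add: leaf_def)
      moreover have "up q = {p, x # p}" using child by (auto simp: up_def parent_child)
      ultimately have "up q \<in> ?C" using child(2,3) by blast
      then show ?thesis by blast
    qed
  qed
  have "T \<subseteq> up ` {p \<in> nds. length p \<le> Suc k + 2}" by (auto simp: T_def)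
  then have "T \<union> ?C = up ` {p \<in> nds. length p \<le> Suc k + 2}"
    by (intro equalityI Un_least image_subsetI C_sub) (simp_all only: mem_Collect_eq sup)
  then show ?case using Suc by (simp add: T_def)
qed

text \<open>Every node of \<open>S\<close> reaches one fixed end \<open>z\<close> of the root edge
  through its ancestors, and adjacency is symmetric.\<close>

lemma connected_subtree:
  assumes "S \<subseteq> nds" "\<And>p. p \<in> S \<Longrightarrow> parent p \<in> S"
  shows "connected_edges (up ` S)"
proof -
  define r where "r = {(a, b). {a, b} \<in> up ` S}"
  have sym: "sym (r\<^sup>*)" by (intro sym_rtrancl) (auto simp: r_def sym_def insert_commute)
  obtain z where z: "z \<in> nds" "length z = 2" by (rule root_node)
  have "(p, z) \<in> r\<^sup>*" if "p \<in> nds" "p \<in> S" for p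
    using that
  proof (induction rule: nodes.induct)
    case (root u v)
    then have "[u, v] \<in> nds" by (intro nodes.root)
    then have "up [u, v] = up z" using up_root z by simp
    then have "z = [u, v] \<or> {[u, v], z} = up [u, v]" by (auto simp: up_def doubleton_eq_iff)
    then show ?case using root(2) by (auto simp: r_def)
  next
    case (child p x)
    have "parent (x # p) = p" using child by (simp add: parent_child)
    then have "p \<in> S" "{x # p, p} = up (x # p)" using assms(2)[of "x # p"] child by (auto simp: up_def)
    then have "(x # p, p) \<in> r" using child by (auto simp: r_def)
    then show ?case using child \<open>p \<in> S\<close> by (meson converse_rtrancl_into_rtrancl)
  qed
  moreover have "\<Union>(up ` S) \<subseteq> S" using assms by (auto simp: up_def)
  ultimately have "(p, q) \<in> r\<^sup>*" if "p \<in> \<Union>(up ` S)" "q \<in> \<Union>(up ` S)" for p q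
    using that sym assms(1) by (meson subsetD symD rtrancl_trans)
  then show ?thesis unfolding connected_edges_def r_def by blast
qed

subsection \<open>Matchings of the tree and their projection to the graph\<close>

text \<open>The projection of \<open>N\<close> to the graph, real-valued so that differences of
  projections can serve as LP directions.\<close>

definition copies :: "'a list set set \<Rightarrow> 'a set \<Rightarrow> real" where
  "copies N f = real (card {t \<in> N. hd ` t = f})"

lemma tree_weight_eq:
  assumes "finite N" "N \<subseteq> up ` nds"
  shows "tree_weight w N = (\<Sum>f\<in>E. w f * copies N f)"
proof -
  have "(\<Sum>t\<in>N. w (hd ` t)) = (\<Sum>f\<in>E. \<Sum>t\<in>{t \<in> N. hd ` t = f}. w (hd ` t))"
    using assms finite_E hd_up_edge by (intro sum.group[symmetric]) auto
  also have "\<dots> = (\<Sum>f\<in>E. w f * copies N f)"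
    by (intro sum.cong) (auto simp: copies_def)
  finally show ?thesis by (simp add: tree_weight_def)
qed

text \<open>A tree edge over an edge at \<open>i\<close> has exactly one end copying
  \<open>i\<close>, and edges of a matching are disjoint. Hence counting such edges amounts to
  counting covered copies of \<open>i\<close>.\<close>

lemma load_copies:
  assumes fin: "finite N" and sub: "N \<subseteq> up ` nds" and m: "matching T N"
  shows "load E (copies N) i = real (card {p \<in> \<Union>N. hd p = i})"
proof -
  have edge: "hd ` t \<in> E" "inj_on hd t" "finite t" if "t \<in> N" for t
    using that sub hd_up_edge inj_on_hd_up by (auto simp: up_def)
  define A where "A = {t \<in> N. i \<in> hd ` t}"
  have "load E (copies N) i = real (\<Sum>f\<in>{f \<in> E. i \<in> f}. card {t \<in> N. hd ` t = f})"
    by (simp add: load_eq_sum_incident copies_def)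
  also have "(\<Sum>f\<in>{f \<in> E. i \<in> f}. card {t \<in> N. hd ` t = f})
      = card (\<Union>f\<in>{f \<in> E. i \<in> f}. {t \<in> N. hd ` t = f})"
    using finite_E fin by (intro card_UN_disjoint[symmetric]) auto
  also have "(\<Union>f\<in>{f \<in> E. i \<in> f}. {t \<in> N. hd ` t = f}) = A"
    using edge by (auto simp: A_def)
  also have "card A = (\<Sum>t\<in>A. card {p \<in> t. hd p = i})"
  proof -
    have "card {p \<in> t. hd p = i} = 1" if "t \<in> A" for t
    proof -
      obtain p where "p \<in> t" "hd p = i" using \<open>t \<in> A\<close> by (auto simp: A_def)
      then have "{p \<in> t. hd p = i} = {p}"
        using edge(2)[of t] that by (auto simp: A_def inj_on_def)
      then show ?thesis by simp
    qed
    then show ?thesis by simp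
  qed
  also have "\<dots> = card (\<Union>t\<in>A. {p \<in> t. hd p = i})"
  proof (intro card_UN_disjoint[symmetric])
    show "\<forall>t\<in>A. \<forall>s\<in>A. t \<noteq> s \<longrightarrow> {p \<in> t. hd p = i} \<inter> {p \<in> s. hd p = i} = {}"
    proof (intro ballI impI)
      fix t s assume "t \<in> A" "s \<in> A" "t \<noteq> s"
      then have "t \<inter> s = {}" using m by (simp add: A_def matching_def)
      then show "{p \<in> t. hd p = i} \<inter> {p \<in> s. hd p = i} = {}" by blast
    qed
  qed (use fin edge in \<open>auto simp: A_def\<close>)
  also have "(\<Union>t\<in>A. {p \<in> t. hd p = i}) = {p \<in> \<Union>N. hd p = i}"
    by (auto simp: A_def)
  finally show ?thesis .
qed

text \<open>In a forest, an edge in the symmetric difference of two matchings with the same covered nodes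
  forces another such edge one level deeper.\<close>

lemma deeper_difference:
  assumes "matching T M" "matching T N" "M \<subseteq> up ` nds" "N \<subseteq> up ` nds" "\<Union>M = \<Union>N"
    and p: "p \<in> nds" "up p \<in> M - N"
  shows "\<exists>q\<in>nds. up q \<in> N - M \<and> length q > length p"
proof -
  \<comment> \<open>The edge of \<open>N\<close> covering \<open>p\<close> is not its parent edge,
    so it leads to a child; it is not in \<open>M\<close>, which already covers \<open>p\<close>
    from above.\<close>
  have "p \<in> \<Union>N" using p assms(5) by (auto simp: up_def)
  then obtain q where q: "q \<in> nds" "up q \<in> N" "p \<in> up q" using assms(4) by blast
  have ne: "up q \<noteq> up p" using q p by auto
  have "length q > length p" by (rule incident_cases[OF p(1) q(1,3)]) (use ne in auto)
  moreover have "up q \<notin> M"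
    using assms(1) p q ne by (force simp: matching_def up_def)
  ultimately show ?thesis using q by blast
qed

text \<open>A deepest edge of the symmetric difference would force a still deeper one; the bound
  \<open>n\<close> ensures that a deepest edge exists.\<close>

lemma same_cover_imp_eq:
  assumes "matching T M" "matching T N" "\<Union>M = \<Union>N"
    and sub: "M \<subseteq> up ` {p \<in> nds. length p \<le> n}" "N \<subseteq> up ` {p \<in> nds. length p \<le> n}"
  shows "M = N"
proof (rule ccontr)
  assume "M \<noteq> N"
  define D where "D = (M - N) \<union> (N - M)"
  define L where "L = length ` {p \<in> nds. up p \<in> D}"
  have sub': "M \<subseteq> up ` nds" "N \<subseteq> up ` nds" using sub by auto
  \<comment> \<open>The bound is given for some name \<open>q\<close> of the edge; all names of an
    edge have the same length.\<close>
  have "length p \<le> n" if p: "p \<in> nds" "up p \<in> D" for p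
  proof -
    obtain q where "q \<in> nds" "length q \<le> n" "up p = up q" using p sub by (auto simp: D_def)
    then show ?thesis using up_eqD[of p q] p by auto
  qed
  then have "L \<subseteq> {..n}" by (auto simp: L_def)
  then have fin: "finite L" by (rule finite_subset) simp
  moreover have "L \<noteq> {}" using \<open>M \<noteq> N\<close> sub' by (auto simp: L_def D_def)
  ultimately have "Max L \<in> L" by simp
  then obtain p where p: "p \<in> nds" "up p \<in> D" "length p = Max L" by (auto simp: L_def)
  have "\<exists>q\<in>nds. up q \<in> D \<and> length q > length p"
    using deeper_difference[of T M N p] deeper_difference[of T N M p] assms(1-3) sub' p
    by (auto simp: D_def)
  then obtain q where "q \<in> nds" "up q \<in> D" "length q > Max L" using p by auto
  then show False using Max_ge[OF fin, of "length q"] by (auto simp: L_def)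
qed

end

subsection \<open>A tree whose optimal matching has the prescribed root value\<close>

locale fractional_edge = unique_lp V E w X + graph_edge V E e
  for V :: "'a set" and E w X e +
  fixes b :: bool
  assumes frac: "0 < X e" "X e < 1"
begin

text \<open>Fixing one candidate makes the matched child unique. Without a candidate the value is
  arbitrary, which is why \<open>sel\<close> tests positivity again.\<close>

definition choice :: "'a list \<Rightarrow> 'a" where
  "choice p = (SOME x. x \<in> neighbors E (hd p) \<and> x \<noteq> hd (tl p) \<and> 0 < X {x, hd p})"

text \<open>The nodes matched to their parent, chosen greedily from the root: \<open>b\<close> decides the root edge,
  and a node not matched to its parent is matched to a child along a positive edge, if any.\<close>

primrec sel :: "'a list \<Rightarrow> bool" where
  "sel [] = False"
| "sel (x # p) = (if length p \<le> 1 then b else \<not> sel p \<and> x = choice p \<and> 0 < X {x, hd p})"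

lemma sel_child: "p \<in> nds \<Longrightarrow> sel (x # p) \<longleftrightarrow> \<not> sel p \<and> x = choice p \<and> 0 < X {x, hd p}"
  using node_length[of p] by auto

lemma sel_root: "p \<in> nds \<Longrightarrow> length p = 2 \<Longrightarrow> sel p = b"
  by (erule node_shape) auto

lemma choice:
  assumes "x \<in> neighbors E (hd p)" "x \<noteq> hd (tl p)" "0 < X {x, hd p}"
  shows "choice p \<in> neighbors E (hd p)" "choice p \<noteq> hd (tl p)" "0 < X {choice p, hd p}"
  unfolding choice_def atomize_conj by (rule someI[of _ x]) (use assms in blast)

lemma sel_pos: "p \<in> nds \<Longrightarrow> sel p \<Longrightarrow> 0 < X {hd p, hd (tl p)}"
  by (cases rule: nodes.cases[of p E e]) (use frac in \<open>auto simp: sel_child simp del: sel.simps(2)\<close>)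

text \<open>An edge of value 1 forces all other edges at its upper end to 0. That end is then not
  matched upwards, and its only positive edge is the one chosen, so the lower end would be
  selected.\<close>

lemma not_sel_less_1:
  assumes "p \<in> nds" "\<not> sel p"
  shows "X {hd p, hd (tl p)} < 1"
  using assms(1)
proof (cases rule: nodes.cases)
  case (root u v)
  then show ?thesis using frac by simp
next
  case (child q x)
  have xE: "{x, hd q} \<in> E" using child by (auto simp: neighbors_def insert_commute)
  show ?thesis
  proof (rule ccontr)
    assume "\<not> ?thesis"
    then have ge: "X {x, hd q} \<ge> 1" using child by simp
    have "X {y, hd q} = 0" if "{y, hd q} \<in> E" "y \<noteq> x" for y
      using two_edges_le_1[of "{x, hd q}" "{y, hd q}" "hd q"] xE edge_neq[OF xE] ge that X_nonneg[OF that(1)]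
      by (auto simp: doubleton_eq_iff)
    note zero = this
    \<comment> \<open>A selected \<open>q\<close> would have a positive parent edge, which differs
      from the edge to \<open>x\<close> since walks do not backtrack.\<close>
    have "\<not> sel q"
      using sel_pos[of q] zero[of "hd (tl q)"] child node_edge[of q]
      by (auto simp: insert_commute)
    then have "x \<noteq> choice q" using assms child ge by (auto simp: sel_child simp del: sel.simps(2))
    moreover have "choice q \<in> neighbors E (hd q)" "0 < X {choice q, hd q}"
      using choice[of x q] child ge by auto
    ultimately show False using zero[of "choice q"] by (auto simp: neighbors_def insert_commute)
  qed
qed

text \<open>The parent edge carries less than the full load 1, so some other edge at
  \<open>hd p\<close> is positive, and it leads to a child.\<close>

lemma matched_child:
  assumes "p \<in> nds" "load E X (hd p) = 1" "\<not> sel p"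
  shows "choice p # p \<in> nds" "sel (choice p # p)"
proof -
  have "\<exists>f\<in>{f \<in> E. hd p \<in> f} - {{hd p, hd (tl p)}}. X f \<noteq> 0"
  proof (rule ccontr)
    assume none: "\<not> ?thesis"
    have "load E X (hd p) = sum X {{hd p, hd (tl p)}}"
      unfolding load_eq_sum_incident
    proof (rule sum.mono_neutral_right)
      show "{{hd p, hd (tl p)}} \<subseteq> {f \<in> E. hd p \<in> f}" using node_edge[OF assms(1)] by simp
      show "finite {f \<in> E. hd p \<in> f}" using finite_E by simp
      show "\<forall>f\<in>{f \<in> E. hd p \<in> f} - {{hd p, hd (tl p)}}. X f = 0" using none by blast
    qed
    then show False using not_sel_less_1[OF assms(1,3)] assms(2) by simp
  qed
  then obtain f where "f \<in> E" "hd p \<in> f" "f \<noteq> {hd p, hd (tl p)}" "X f \<noteq> 0"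
    by blast
  then have f: "f \<in> E" "hd p \<in> f" "f \<noteq> {hd p, hd (tl p)}" "0 < X f"
    using X_nonneg[of f] by auto
  obtain x where "x \<in> neighbors E (hd p)" "f = {hd p, x}"
    by (rule edge_other_end[OF f(1,2)])
  then have "x \<in> neighbors E (hd p)" "x \<noteq> hd (tl p)" "0 < X {x, hd p}"
    using f by (auto simp: insert_commute)
  note c = choice[OF this]
  show "choice p # p \<in> nds" using c assms by (intro nodes.child)
  show "sel (choice p # p)" using c assms by (simp add: sel_child del: sel.simps)
qed

context
  fixes n :: nat
  assumes n: "2 \<le> n"
begin

text \<open>Selected nodes one level further are included so that nodes of length \<open>n\<close>
  keep their matching edges; they are themselves covered from above.\<close>

definition S where "S = {p \<in> nds. length p \<le> n \<or> length p = Suc n \<and> sel p}"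
definition T where "T = up ` S"
definition M where "M = up ` {p \<in> S. sel p}"

lemma S_bound: "S \<subseteq> {p \<in> nds. length p \<le> Suc n}"
  by (auto simp: S_def)

lemma finite_T: "finite T"
  using finite_subset[OF S_bound finite_nodes] by (simp add: T_def)

lemma parent_S: "p \<in> S \<Longrightarrow> parent p \<in> S"
  using n by (auto simp: S_def parent_node length_parent)

lemma Union_T: "\<Union>T = S"
  using parent_S by (auto simp: T_def up_def)

lemma M_subset: "M \<subseteq> T"
  by (auto simp: M_def T_def)

text \<open>Only the root edge has two names, and \<open>sel\<close> has the value \<open>b\<close>
  at both. Selection is thus a property of edges.\<close>

lemma sel_up_eq:
  assumes "p \<in> nds" "q \<in> nds" "up p = up q"
  shows "sel p = sel q"
  using up_eqD[OF assms(3,1,2)] assms sel_root by metis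

lemma matching_M: "matching T M"
  unfolding matching_def
proof (intro conjI ballI impI)
  fix s t assume "s \<in> M" "t \<in> M" "s \<noteq> t"
  then obtain p q where pq: "s = up p" "t = up q" "p \<in> nds" "q \<in> nds" "sel p" "sel q"
    by (auto simp: M_def S_def)
  show "s \<inter> t = {}"
  proof (rule ccontr)
    assume "s \<inter> t \<noteq> {}"
    then obtain r where r: "r \<in> up p" "r \<in> up q" using pq by auto
    then have rn: "r \<in> nds" using mem_up_node pq by blast
    \<comment> \<open>At \<open>r\<close> only one edge can be selected: the parent edge if
      \<open>sel r\<close>, and otherwise the edge to \<open>choice r\<close>.\<close>
    have alt: "up q' = up r \<and> sel r \<or> q' = choice r # r \<and> \<not> sel r"
      if "q' \<in> nds" "sel q'" "r \<in> up q'" for q'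
    proof (rule incident_cases[OF rn that(1,3)])
      assume "up q' = up r"
      then show ?thesis using sel_up_eq rn that by blast
    next
      fix x assume "q' = x # r"
      then show ?thesis using that(2) sel_child[OF rn] by (simp del: sel.simps)
    qed
    then show False using alt[of p] alt[of q] pq r \<open>s \<noteq> t\<close> by auto
  qed
qed (rule M_subset)

lemma root_in_T: "root_edge e \<in> T"
proof -
  obtain z where "z \<in> nds" "length z = 2" by (rule root_node)
  then show ?thesis using up_root[of z] n by (force simp: T_def S_def)
qed

lemma root_in_M: "root_edge e \<in> M \<longleftrightarrow> b"
proof -
  obtain z where z: "z \<in> nds" "length z = 2" by (rule root_node)
  then have root: "root_edge e = up z" using up_root[of z] by simp
  have "z \<in> S" using z n by (simp add: S_def)
  moreover have "sel p = b" if "p \<in> nds" "up p = up z" for p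
    using sel_up_eq[OF that(1) z(1) that(2)] sel_root z by simp
  ultimately show ?thesis using sel_root[OF z] by (auto simp: M_def S_def root)
qed

lemma saturated_covered:
  assumes "p \<in> \<Union>T" "load E X (hd p) = 1"
  shows "p \<in> \<Union>M"
proof (cases "sel p")
  case True
  then show ?thesis using assms Union_T by (auto simp: M_def up_def)
next
  case False
  \<comment> \<open>An unselected node of \<open>S\<close> has length at most \<open>n\<close>, so
    its matched child still lies in \<open>S\<close>.\<close>
  have p: "p \<in> nds" "length p \<le> n" using assms(1) False by (auto simp: Union_T S_def)
  note m = matched_child[OF p(1) assms(2) False]
  have "p \<in> up (choice p # p)" using p by (simp add: up_def parent_child)
  moreover have "choice p # p \<in> {p \<in> S. sel p}"
    using m p by (auto simp: S_def simp del: sel.simps)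
  ultimately show ?thesis unfolding M_def by blast
qed

lemma computation_tree_T: "computation_tree E e T"
proof -
  have "T \<subseteq> full_tree E e (Suc n)" unfolding full_tree_eq T_def using S_bound by force
  moreover have "connected_edges T"
    unfolding T_def by (rule connected_subtree) (auto simp: parent_S, auto simp: S_def)
  ultimately show ?thesis using root_in_T by (auto simp: computation_tree_def)
qed

lemma copies_M_pos: "copies M f > 0 \<Longrightarrow> X f > 0"
proof -
  assume "copies M f > 0"
  then have "{t \<in> M. hd ` t = f} \<noteq> {}" by (auto simp: copies_def card_gt_0_iff)
  then obtain p where "p \<in> nds" "sel p" "hd ` up p = f" by (auto simp: M_def S_def)
  then show ?thesis using sel_pos hd_up by metis
qed

lemma other_matching_lighter:
  assumes N: "matching T N" "N \<noteq> M"
  shows "tree_weight w N < tree_weight w M"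
proof -
  have Tn: "T \<subseteq> up ` {p \<in> nds. length p \<le> Suc n}" using S_bound by (auto simp: T_def)
  have "N \<subseteq> T" using N by (auto simp: matching_def)
  then have fin: "finite N" "finite M" using M_subset finite_T finite_subset by auto
  have sub: "N \<subseteq> up ` nds" "M \<subseteq> up ` nds" using \<open>N \<subseteq> T\<close> M_subset Tn by auto
  have finU: "finite {p \<in> \<Union>M. hd p = i}" for i
  proof (rule finite_subset)
    show "{p \<in> \<Union>M. hd p = i} \<subseteq> S" using Union_T M_subset by blast
    show "finite S" by (rule finite_subset[OF S_bound finite_nodes])
  qed
  define d where "d f = copies N f - copies M f" for f
  have load_d: "load E d i = real (card {p \<in> \<Union>N. hd p = i}) - real (card {p \<in> \<Union>M. hd p = i})" for i
    using load_copies[OF fin(1) sub(1) N(1)] load_copies[OF fin(2) sub(2) matching_M]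
    by (simp add: load_def d_def sum_subtractf)
  \<comment> \<open>Where the direction decreases, \<open>M\<close> has a copy, and \<open>M\<close>
    uses positive edges only.\<close>
  have neg: "X f > 0" if "d f < 0" for f
  proof (rule copies_M_pos)
    have "copies N f \<ge> 0" by (simp add: copies_def)
    then show "copies M f > 0" using that by (simp add: d_def)
  qed
  \<comment> \<open>\<open>M\<close> covers every copy of a saturated vertex in the tree, so
    \<open>N\<close> cannot cover more.\<close>
  have sat: "load E d i \<le> 0" if "load E X i = 1" for i
  proof -
    have "{p \<in> \<Union>N. hd p = i} \<subseteq> {p \<in> \<Union>M. hd p = i}"
      using saturated_covered \<open>N \<subseteq> T\<close> that by blast
    then show ?thesis using card_mono[OF finU] by (simp add: load_d)
  qed
  have diff: "(\<Sum>f\<in>E. w f * d f) = tree_weight w N - tree_weight w M"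
    using tree_weight_eq[OF fin(1) sub(1)] tree_weight_eq[OF fin(2) sub(2)]
    by (simp add: d_def algebra_simps sum_subtractf)
  have "tree_weight w N \<noteq> tree_weight w M"
  proof
    assume "tree_weight w N = tree_weight w M"
    then have zero: "d f = 0" if "f \<in> E" for f
      using perturbation(2)[of d f] neg sat diff that by auto
    \<comment> \<open>With equal projections, edges of \<open>N\<close> also copy positive edges.
      Their ends are saturated and hence covered by \<open>M\<close>.\<close>
    have cover: "\<Union>N \<subseteq> \<Union>M"
    proof
      fix p assume p: "p \<in> \<Union>N"
      then obtain q where q: "q \<in> nds" "up q \<in> N" "p \<in> up q" using sub by blast
      then have "{t \<in> N. hd ` t = hd ` up q} \<noteq> {}" by auto
      then have "copies N (hd ` up q) > 0" using fin by (simp add: copies_def card_gt_0_iff)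
      then have "copies M (hd ` up q) > 0" using zero[OF hd_up_edge[OF q(1)]] by (simp add: d_def)
      then have "load E X (hd p) = 1"
        using positive_edge_saturated[OF hd_up_edge[OF q(1)]] copies_M_pos q by blast
      then show "p \<in> \<Union>M" using saturated_covered p \<open>N \<subseteq> T\<close> by blast
    qed
    \<comment> \<open>Zero load of \<open>d\<close> means equally many covered copies of each
      vertex, which turns the inclusion into equality.\<close>
    have "\<Union>M \<subseteq> \<Union>N"
    proof
      fix p assume p: "p \<in> \<Union>M"
      have "load E d (hd p) = 0" using zero by (simp add: load_eq_sum_incident)
      then have "card {q \<in> \<Union>N. hd q = hd p} = card {q \<in> \<Union>M. hd q = hd p}"
        by (simp add: load_d)
      moreover have "{q \<in> \<Union>N. hd q = hd p} \<subseteq> {q \<in> \<Union>M. hd q = hd p}" using cover by blast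
      ultimately have "{q \<in> \<Union>N. hd q = hd p} = {q \<in> \<Union>M. hd q = hd p}"
        using card_subset_eq[OF finU] by blast
      then show "p \<in> \<Union>N" using p by blast
    qed
    then have "\<Union>N = \<Union>M" using cover by blast
    then have "N = M"
      using same_cover_imp_eq[OF N(1) matching_M, of "Suc n"] Tn \<open>N \<subseteq> T\<close> M_subset by blast
    then show False using N by simp
  qed
  moreover have "tree_weight w N \<le> tree_weight w M"
    using perturbation(1)[of d] neg sat diff by auto
  ultimately show ?thesis by simp
qed

text \<open>\<open>M\<close> has root value \<open>b\<close>, so every matching with the other value
  differs from \<open>M\<close> and is strictly lighter.\<close>

lemma belief_T: "belief w e T (\<not> b) < belief w e T b"
proof -
  define W where "W c = {tree_weight w N | N. matching T N \<and> (root_edge e \<in> N \<longleftrightarrow> c)}" for c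
  have fin: "finite (W c)" for c
  proof (rule finite_subset)
    show "W c \<subseteq> tree_weight w ` Pow T" by (auto simp: W_def matching_def)
  qed (use finite_T in simp)
  \<comment> \<open>A matching with root value opposite to \<open>b\<close>, so that the maximum is
    over a nonempty set.\<close>
  have "matching T (if b then {} else {root_edge e})"
    using root_in_T by (auto simp: matching_def)
  then have ne: "W (\<not> b) \<noteq> {}" by (auto simp: W_def split: if_splits)
  have "Max (W (\<not> b)) < tree_weight w M"
    using other_matching_lighter root_in_M
    by (subst Max_less_iff[OF fin ne]) (auto simp: W_def)
  also have "\<dots> \<le> Max (W b)"
    using fin matching_M root_in_M by (intro Max_ge) (auto simp: W_def)
  finally show ?thesis by (simp add: belief_def W_def)
qed

end

lemma tree_with_belief:
  "\<exists>T. computation_tree E e T \<and> full_up_to E e k T \<and> belief w e T (\<not> b) < belief w e T b"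
proof (intro exI conjI)
  \<comment> \<open>Lists in the full tree of depth \<open>k\<close> have length at most
    \<open>Suc k\<close>; \<open>Suc (Suc k)\<close> exceeds this and is at least 2 also for
    \<open>k = 0\<close>.\<close>
  have "full_tree E e k \<subseteq> T (Suc (Suc k))"
    by (cases k) (auto simp: full_tree_eq T_def S_def simp del: full_tree.simps(3))
  then show "full_up_to E e k (T (Suc (Suc k)))" by (simp add: full_up_to_def)
qed (simp_all add: computation_tree_T belief_T)

end

section \<open>Incorrect beliefs and divergence\<close>

text \<open>Supplies the trees for the edges other than the fractional one under
  consideration.\<close>

lemma (in graph_edge) full_tree_is_computation_tree: "computation_tree E e (full_tree E e (Suc k))"
proof -
  let ?S = "{p \<in> nds. length p \<le> k + 2}"
  obtain z where "z \<in> nds" "length z = 2" by (rule root_node)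
  then have "root_edge e \<in> up ` ?S" using up_root[of z] by force
  moreover have "connected_edges (up ` ?S)"
    by (rule connected_subtree) (auto simp: parent_node length_parent)
  ultimately show ?thesis unfolding computation_tree_def full_tree_eq[symmetric] by blast
qed

lemma full_tree_mono: "full_tree E e k \<subseteq> full_tree E e (Suc k)"
  by (cases k) auto

theorem theorem2:
  fixes V :: "'a set" and E :: "'a set set" and w :: "'a set \<Rightarrow> real" and Mstar :: "'a set set"
  assumes "finite_simple_graph V E"
    and "\<And>e. e \<in> E \<Longrightarrow> 0 \<le> w e"
    and "max_weight_matching E w Mstar"
    and "\<And>M. max_weight_matching E w M \<Longrightarrow> M = Mstar"
    and "\<exists>!x. lp_optimal V E w x"
    and "lp_loose V E w"
  shows "\<not> max_product_converges_to E w Mstar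
    \<and> (\<forall>k. \<exists>k1\<ge>k. \<exists>T. (\<forall>e\<in>E. computation_tree E e (T e) \<and> full_up_to E e k1 (T e))
          \<and> (\<exists>e\<in>E. incorrect_belief w Mstar e (T e)))
    \<and> \<not> max_product_converges E w"
proof -
  obtain X where X: "lp_optimal V E w X" "\<And>y. lp_optimal V E w y \<Longrightarrow> y = X"
    using assms(5) by blast
  interpret unique_lp V E w X by unfold_locales (rule assms(1), rule X(1), erule X(2))
  \<comment> \<open>As the optimum is unique, looseness can only come from a non-integral
    coordinate.\<close>
  obtain e where e: "e \<in> E" "X e \<notin> {0, 1}"
    using assms(6) X unfolding lp_loose_def lp_tight_def by blast
  then have frac: "0 < X e" "X e < 1"
    using X_nonneg[OF e(1)] X_le_1[OF e(1)] by auto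
  have tree: "\<exists>T. computation_tree E e T \<and> full_up_to E e k T \<and> belief w e T (\<not> b) < belief w e T b"
    for k b
  proof -
    interpret fractional_edge V E w X e b by unfold_locales (use e frac in auto)
    show ?thesis by (rule tree_with_belief)
  qed
  have diverges: "\<not> max_product_converges E w"
  proof
    assume "max_product_converges E w"
    then obtain k where "converges_by E w k" by (auto simp: max_product_converges_def)
    then obtain A where A: "\<And>T. computation_tree E e T \<Longrightarrow> full_up_to E e k T \<Longrightarrow>
        best_assignments w e T = A"
      using e(1) unfolding converges_by_def by meson
    \<comment> \<open>Both root values are strictly best on trees full up to depth \<open>k\<close>,
      so no single set \<open>A\<close> fits.\<close>
    have "b \<in> A \<and> (\<not> b) \<notin> A" for b
    proof -
      obtain T where T: "computation_tree E e T" "full_up_to E e k T"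
          "belief w e T (\<not> b) < belief w e T b"
        using tree by blast
      have "belief w e T c \<le> belief w e T b" for c using T(3) by (cases "c = b") auto
      moreover have "\<not> belief w e T b \<le> belief w e T (\<not> b)" using T(3) by simp
      ultimately have "b \<in> best_assignments w e T" "(\<not> b) \<notin> best_assignments w e T"
        unfolding best_assignments_def by blast+
      then show ?thesis using A[OF T(1,2)] by simp
    qed
    then show False by blast
  qed
  moreover have "\<exists>k1\<ge>k. \<exists>T. (\<forall>e\<in>E. computation_tree E e (T e) \<and> full_up_to E e k1 (T e))
      \<and> (\<exists>e\<in>E. incorrect_belief w Mstar e (T e))" for k
  proof -
    \<comment> \<open>The root value is prescribed to contradict \<open>Mstar\<close>.\<close>
    obtain T where T: "computation_tree E e T" "full_up_to E e k T"
        "belief w e T (e \<in> Mstar) < belief w e T (e \<notin> Mstar)"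
      using tree[of k "e \<notin> Mstar"] by auto
    \<comment> \<open>Depth \<open>Suc k\<close> is used because the tree of depth 0 is empty and
      lacks the root edge.\<close>
    define T' where "T' = (\<lambda>f. full_tree E f (Suc k))(e := T)"
    have "computation_tree E f (T' f) \<and> full_up_to E f k (T' f)" if "f \<in> E" for f
    proof -
      interpret graph_edge V E f by unfold_locales (fact that)
      show ?thesis
        using T(1,2) full_tree_is_computation_tree[of k] full_tree_mono[of E f k]
        by (cases "f = e") (simp_all add: T'_def full_up_to_def del: full_tree.simps)
    qed
    moreover have "incorrect_belief w Mstar e (T' e)"
      using T(3) by (cases "e \<in> Mstar") (auto simp: incorrect_belief_def T'_def)
    ultimately show ?thesis using e(1) by blast
  qed
  moreover have "\<not> max_product_converges_to E w Mstar"
    using diverges by (auto simp: max_product_converges_to_def max_product_converges_def)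
  ultimately show ?thesis by blast
qed

end
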